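(* Let $G$ be a group with a Lee metric $d_{Lee}$. Then $d_{Lee}$ is bi-invariant if and only if $G$ is abelian or $G\cong\mathbb{Q}_8\times\mathbb{Z}_2^k$ for some integer $k\ge 0$.
   Context: $\mathbb{Q}_8=\{\pm1,\pm i,\pm j,\pm k\}$ is the quaternion group of order 8. All metrics on groups are integral (integer valued) and right translation invariant: $d(gh,g'h)=d(g,g')$ for all $g,g',h\in G$. Such a $d$ is bi-invariant if moreover $d(hg,hg')=d(g,g')$ for all $g,g',h\in G$. The weight of $d$ is $w(x)=d(x,e)$, $e$ the identity of $G$. The partition induced by $d$, denoted $P(G,d)$, is the set of classes of the equivalence relation $g\sim h\Leftrightarrow w(g)=w(h)$. An interval metric is a (right invariant, integral) metric $d$ with finitely many weights and without gaps: if $P(G,d)$ has $n$ parts different from $\{e\}$, then the set of values of $w$ is exactly $\{0,1,\ldots,n\}$. The Lee partition of $G$ is $\mathcal{P}_{Lee}(G)=\{\{a,a^{-1}\}:a\in G\}$. A Lee metric on $G$ is an interval metric $d$ on $G$ with $P(G,d)=\mathcal{P}_{Lee}(G)$ (so with this definition $G$ is finite). *)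

theory Defs
  imports
    "HOL-Algebra.Product_Groups"
    "HOL-Algebra.Elementary_Groups"
    "HOL-Analysis.Abstract_Metric_Spaces"
begin

(* Metric_space also asks for symmetry and nonnegativity off the carrier.  This is
   only a convention on junk values: no other definition below looks at d outside the
   carrier, and a metric on the carrier can be extended by 0. *)
definition right_invariant_metric :: "('a, 'b) monoid_scheme \<Rightarrow> ('a \<Rightarrow> 'a \<Rightarrow> int) \<Rightarrow> bool"
  where "right_invariant_metric G d \<longleftrightarrow>
    Metric_space (carrier G) (\<lambda>x y. real_of_int (d x y)) \<and>
    (\<forall>g\<in>carrier G. \<forall>g'\<in>carrier G. \<forall>h\<in>carrier G.
       d (g \<otimes>\<^bsub>G\<^esub> h) (g' \<otimes>\<^bsub>G\<^esub> h) = d g g')"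

definition bi_invariant_metric :: "('a, 'b) monoid_scheme \<Rightarrow> ('a \<Rightarrow> 'a \<Rightarrow> int) \<Rightarrow> bool"
  where "bi_invariant_metric G d \<longleftrightarrow>
    right_invariant_metric G d \<and>
    (\<forall>g\<in>carrier G. \<forall>g'\<in>carrier G. \<forall>h\<in>carrier G.
       d (h \<otimes>\<^bsub>G\<^esub> g) (h \<otimes>\<^bsub>G\<^esub> g') = d g g')"

definition weight :: "('a, 'b) monoid_scheme \<Rightarrow> ('a \<Rightarrow> 'a \<Rightarrow> int) \<Rightarrow> 'a \<Rightarrow> int"
  where "weight G d x = d x \<one>\<^bsub>G\<^esub>"

definition metric_partition :: "('a, 'b) monoid_scheme \<Rightarrow> ('a \<Rightarrow> 'a \<Rightarrow> int) \<Rightarrow> 'a set set"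
  where "metric_partition G d =
    carrier G // {(g, h). g \<in> carrier G \<and> h \<in> carrier G \<and> weight G d g = weight G d h}"

definition interval_metric :: "('a, 'b) monoid_scheme \<Rightarrow> ('a \<Rightarrow> 'a \<Rightarrow> int) \<Rightarrow> bool"
  where "interval_metric G d \<longleftrightarrow>
    right_invariant_metric G d \<and>
    finite (weight G d ` carrier G) \<and>
    weight G d ` carrier G = {0..int (card (metric_partition G d - {{\<one>\<^bsub>G\<^esub>}}))}"

definition Lee_partition :: "('a, 'b) monoid_scheme \<Rightarrow> 'a set set"
  where "Lee_partition G = {{a, inv\<^bsub>G\<^esub> a} |a. a \<in> carrier G}"

definition Lee_metric :: "('a, 'b) monoid_scheme \<Rightarrow> ('a \<Rightarrow> 'a \<Rightarrow> int) \<Rightarrow> bool"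
  where "Lee_metric G d \<longleftrightarrow> interval_metric G d \<and> metric_partition G d = Lee_partition G"

(* (a, b, c, d) stands for the quaternion a + b i + c j + d k. *)
definition quaternion_mult ::
    "int \<times> int \<times> int \<times> int \<Rightarrow> int \<times> int \<times> int \<times> int \<Rightarrow> int \<times> int \<times> int \<times> int"
  where "quaternion_mult = (\<lambda>(a, b, c, d) (a', b', c', d').
    (a * a' - b * b' - c * c' - d * d',
     a * b' + b * a' + c * d' - d * c',
     a * c' - b * d' + c * a' + d * b',
     a * d' + b * c' - c * b' + d * a'))"

definition Q8 :: "(int \<times> int \<times> int \<times> int) monoid"
  where "Q8 =
    \<lparr>carrier = {(1, 0, 0, 0), (-1, 0, 0, 0), (0, 1, 0, 0), (0, -1, 0, 0),
                (0, 0, 1, 0), (0, 0, -1, 0), (0, 0, 0, 1), (0, 0, 0, -1)},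
     mult = quaternion_mult,
     one = (1, 0, 0, 0)\<rparr>"

definition Z2_power :: "nat \<Rightarrow> (nat \<Rightarrow> int) monoid"
  where "Z2_power k = product_group {..<k} (\<lambda>_. integer_mod_group 2)"

end

theory Submission
  imports Defs
begin

text \<open>Bi-invariance of a Lee metric means that every conjugate of \<open>x\<close> is \<open>x\<close> or its inverse.
  If \<open>a\<close>, \<open>b\<close> do not commute in such a group, then \<open>a\<^sup>2 = b\<^sup>2\<close> has order 2, so \<open>a\<close>, \<open>b\<close> generate a
  copy of the quaternion group, and every element is the product of one of \<open>1, a, b, ab\<close>
  (up to inversion) and a central element of exponent 2.  A finite such group is therefore
  exhausted by extending an embedding of \<open>Q\<^sub>8 \<times> Z\<^sub>2\<^sup>k\<close> by one central involution at a time.\<close>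

section \<open>The conjugation condition and its transport along isomorphisms\<close>

text \<open>The second alternative is \<open>y\<inverse> x y = x\<inverse>\<close>, stated without inverses.\<close>

definition conj_trivial_or_inverting :: "('a, 'b) monoid_scheme \<Rightarrow> bool"
  where "conj_trivial_or_inverting G \<longleftrightarrow> (\<forall>x\<in>carrier G. \<forall>y\<in>carrier G.
    x \<otimes>\<^bsub>G\<^esub> y = y \<otimes>\<^bsub>G\<^esub> x \<or> x \<otimes>\<^bsub>G\<^esub> y \<otimes>\<^bsub>G\<^esub> x = y)"

lemma conj_trivial_or_invertingD:
  assumes "conj_trivial_or_inverting G" "x \<in> carrier G" "y \<in> carrier G"
    and "x \<otimes>\<^bsub>G\<^esub> y \<noteq> y \<otimes>\<^bsub>G\<^esub> x"
  shows "x \<otimes>\<^bsub>G\<^esub> y \<otimes>\<^bsub>G\<^esub> x = y"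
  using assms by (auto simp: conj_trivial_or_inverting_def)

text \<open>Both alternatives are equations between products, so they pull back along an injective
  homomorphism.\<close>

lemma conj_trivial_or_inverting_iso:
  fixes G (structure)
  assumes "G \<cong> H" and "monoid G" and H: "conj_trivial_or_inverting H"
  shows "conj_trivial_or_inverting G"
proof -
  interpret monoid G by fact
  from assms(1) obtain f where f: "f \<in> hom G H" "inj_on f (carrier G)"
    by (auto simp: is_iso_def iso_iff)
  show ?thesis
    unfolding conj_trivial_or_inverting_def
  proof (intro ballI)
    fix x y assume xy: "x \<in> carrier G" "y \<in> carrier G"
    have fxy: "f x \<in> carrier H" "f y \<in> carrier H"
      using f(1) xy by (auto simp: hom_def)
    have "f x \<otimes>\<^bsub>H\<^esub> f y = f y \<otimes>\<^bsub>H\<^esub> f x \<or> f x \<otimes>\<^bsub>H\<^esub> f y \<otimes>\<^bsub>H\<^esub> f x = f y"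
      using H fxy by (auto simp: conj_trivial_or_inverting_def)
    then have "f (x \<otimes> y) = f (y \<otimes> x) \<or> f (x \<otimes> y \<otimes> x) = f y"
      using xy by (simp add: hom_mult[OF f(1)])
    then show "x \<otimes> y = y \<otimes> x \<or> x \<otimes> y \<otimes> x = y"
      using xy by (auto simp: inj_on_eq_iff[OF f(2)])
  qed
qed

section \<open>Arithmetic in elementary abelian 2-groups\<close>

lemma carrier_Z2_power: "carrier (Z2_power k) = (\<Pi>\<^sub>E i\<in>{..<k}. {0, 1})"
proof -
  have "{0..<2} = {0, 1 :: int}" by auto
  then show ?thesis by (simp add: Z2_power_def carrier_integer_mod_group)
qed

lemma mult_Z2_power: "x \<otimes>\<^bsub>Z2_power k\<^esub> y = (\<lambda>i\<in>{..<k}. (x i + y i) mod 2)"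
  by (simp add: Z2_power_def)

lemma one_Z2_power: "\<one>\<^bsub>Z2_power k\<^esub> = (\<lambda>i\<in>{..<k}. 0)"
  by (simp add: Z2_power_def)

lemma group_Z2_power: "group (Z2_power k)"
  by (simp add: Z2_power_def)

lemma Z2_power_commute: "x \<otimes>\<^bsub>Z2_power k\<^esub> y = y \<otimes>\<^bsub>Z2_power k\<^esub> x"
  by (simp add: mult_Z2_power add.commute)

lemma Z2_power_involution:
  assumes "x \<in> carrier (Z2_power k)"
  shows "x \<otimes>\<^bsub>Z2_power k\<^esub> x = \<one>\<^bsub>Z2_power k\<^esub>"
  using assms by (auto simp: mult_Z2_power one_Z2_power carrier_Z2_power intro!: restrict_ext)

lemma restrict_carrier_Z2_power:
  assumes "x \<in> carrier (Z2_power (Suc k))"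
  shows "restrict x {..<k} \<in> carrier (Z2_power k)"
  using assms by (auto simp: carrier_Z2_power PiE_iff)

text \<open>Splits off the last coordinate for the kernel computation in
  \<open>mon_Z2_power_Suc\<close>. Elements are extensional functions, so the values outside the
  index set have to agree as well.\<close>

lemma Z2_power_eq_one_Suc:
  assumes "x \<in> carrier (Z2_power (Suc k))" "restrict x {..<k} = \<one>\<^bsub>Z2_power k\<^esub>" "x k = 0"
  shows "x = \<one>\<^bsub>Z2_power (Suc k)\<^esub>"
proof
  fix i
  have "i < k \<Longrightarrow> x i = 0"
    using fun_cong[OF assms(2), of i] by (simp add: one_Z2_power)
  moreover have "\<not> i < Suc k \<Longrightarrow> x i = undefined"
    using assms(1) by (auto simp: carrier_Z2_power PiE_iff extensional_def)
  ultimately show "x i = \<one>\<^bsub>Z2_power (Suc k)\<^esub> i"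
    using assms(3) by (auto simp: one_Z2_power less_Suc_eq)
qed

section \<open>The quaternion group and its products with elementary abelian 2-groups\<close>

lemma carrier_Q8: "carrier Q8 = {(1, 0, 0, 0), (-1, 0, 0, 0), (0, 1, 0, 0), (0, -1, 0, 0),
                (0, 0, 1, 0), (0, 0, -1, 0), (0, 0, 0, 1), (0, 0, 0, -1)}"
  by (simp add: Q8_def)

lemma mult_Q8: "x \<otimes>\<^bsub>Q8\<^esub> y = quaternion_mult x y"
  by (simp add: Q8_def)

lemma one_Q8: "\<one>\<^bsub>Q8\<^esub> = (1, 0, 0, 0)"
  by (simp add: Q8_def)

lemma quaternion_mult_assoc:
  "quaternion_mult (quaternion_mult x y) z = quaternion_mult x (quaternion_mult y z)"
  by (cases x; cases y; cases z) (simp add: quaternion_mult_def algebra_simps)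

lemma group_Q8: "group Q8"
proof (rule groupI)
  show "\<one>\<^bsub>Q8\<^esub> \<in> carrier Q8" by (simp add: carrier_Q8 one_Q8)
  show "x \<otimes>\<^bsub>Q8\<^esub> y \<in> carrier Q8" if "x \<in> carrier Q8" "y \<in> carrier Q8" for x y
    using that unfolding carrier_Q8
    by (elim insertE emptyE; simp add: mult_Q8 quaternion_mult_def)
  show "x \<otimes>\<^bsub>Q8\<^esub> y \<otimes>\<^bsub>Q8\<^esub> z = x \<otimes>\<^bsub>Q8\<^esub> (y \<otimes>\<^bsub>Q8\<^esub> z)" for x y z
    by (simp add: mult_Q8 quaternion_mult_assoc)
  show "\<one>\<^bsub>Q8\<^esub> \<otimes>\<^bsub>Q8\<^esub> x = x" if "x \<in> carrier Q8" for x
    using that by (auto simp: carrier_Q8 mult_Q8 one_Q8 quaternion_mult_def)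
  show "\<exists>y\<in>carrier Q8. y \<otimes>\<^bsub>Q8\<^esub> x = \<one>\<^bsub>Q8\<^esub>" if "x \<in> carrier Q8" for x
    using that unfolding carrier_Q8
    by (elim insertE emptyE; simp add: mult_Q8 one_Q8 quaternion_mult_def)
qed

text \<open>A product of two such groups can fail the condition, because the factors may choose
  different alternatives. In an abelian group of exponent 2 both alternatives always hold, so the
  \<open>Q8\<close> component decides.\<close>

lemma conj_trivial_or_inverting_Q8_Z2_power:
  "conj_trivial_or_inverting (Q8 \<times>\<times> Z2_power k)"
proof -
  interpret Z: group "Z2_power k" by (rule group_Z2_power)
  have Z: "x \<otimes>\<^bsub>Z2_power k\<^esub> y \<otimes>\<^bsub>Z2_power k\<^esub> x = y"
    if "x \<in> carrier (Z2_power k)" "y \<in> carrier (Z2_power k)" for x y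
  proof -
    have "x \<otimes>\<^bsub>Z2_power k\<^esub> y \<otimes>\<^bsub>Z2_power k\<^esub> x = y \<otimes>\<^bsub>Z2_power k\<^esub> (x \<otimes>\<^bsub>Z2_power k\<^esub> x)"
      using that by (subst Z2_power_commute[of k x]) (simp add: Z.m_assoc)
    then show ?thesis
      using that by (simp add: Z2_power_involution)
  qed
  have Q: "p \<otimes>\<^bsub>Q8\<^esub> q = q \<otimes>\<^bsub>Q8\<^esub> p \<or> p \<otimes>\<^bsub>Q8\<^esub> q \<otimes>\<^bsub>Q8\<^esub> p = q"
    if "p \<in> carrier Q8" "q \<in> carrier Q8" for p q
    using that unfolding carrier_Q8
    by (elim insertE emptyE; simp add: mult_Q8 quaternion_mult_def)
  show ?thesis
    unfolding conj_trivial_or_inverting_def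
    using Q Z by (auto simp: Z2_power_commute)
qed

section \<open>Building embeddings of \<open>Q8\<close> and of its products with
  \<open>Z2_power k\<close>\<close>

text \<open>The equations on \<open>a\<close>, \<open>b\<close>, \<open>z\<close> are relations of
  \<open>Q8\<close> for i, j, -1, and they reduce every product of the eight words to one of these
  words. Any collapse of the image would make \<open>a\<close> and \<open>b\<close> commute.\<close>

lemma (in group) mon_Q8:
  assumes carr: "a \<in> carrier G" "b \<in> carrier G" "z \<in> carrier G"
    and aa: "a \<otimes> a = z" and bb: "b \<otimes> b = z" and zz: "z \<otimes> z = \<one>"
    and ba: "b \<otimes> a = z \<otimes> (a \<otimes> b)" and ne: "a \<otimes> b \<noteq> b \<otimes> a"
  shows "\<exists>f. f \<in> mon Q8 G"
proof -
  define f where "f = (\<lambda>q :: int \<times> int \<times> int \<times> int.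
     if q = (1,0,0,0) then \<one> else if q = (-1,0,0,0) then z
     else if q = (0,1,0,0) then a else if q = (0,-1,0,0) then z \<otimes> a
     else if q = (0,0,1,0) then b else if q = (0,0,-1,0) then z \<otimes> b
     else if q = (0,0,0,1) then a \<otimes> b else z \<otimes> (a \<otimes> b))"
  have az: "a \<otimes> z = z \<otimes> a" and bz: "b \<otimes> z = z \<otimes> b"
    using carr by (metis aa m_assoc, metis bb m_assoc)
  \<comment> \<open>Rewrite rules for right-nested products: \<open>z\<close> moves to the front,
    \<open>a\<close> moves before \<open>b\<close>, and squares are absorbed into
    \<open>z\<close>.\<close>
  have left: "a \<otimes> (a \<otimes> x) = z \<otimes> x" "b \<otimes> (b \<otimes> x) = z \<otimes> x" "z \<otimes> (z \<otimes> x) = x"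
    "b \<otimes> (a \<otimes> x) = z \<otimes> (a \<otimes> (b \<otimes> x))" "a \<otimes> (z \<otimes> x) = z \<otimes> (a \<otimes> x)" "b \<otimes> (z \<otimes> x) = z \<otimes> (b \<otimes> x)"
    if "x \<in> carrier G" for x
    using that carr by (simp_all flip: m_assoc add: aa bb zz ba az bz)
  note table = aa bb zz ba az bz left m_assoc carr
  have hom: "f \<in> hom Q8 G"
  proof (rule homI)
    fix p q assume "p \<in> carrier Q8" "q \<in> carrier Q8"
    then show "f (p \<otimes>\<^bsub>Q8\<^esub> q) = f p \<otimes> f q"
      unfolding carrier_Q8
      by (elim insertE emptyE; simp add: f_def mult_Q8 quaternion_mult_def table)
  qed (auto simp: f_def carr)
  interpret f: group_hom Q8 G f
    using hom group_Q8 is_group by (simp add: group_hom_def group_hom_axioms_def)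
  \<comment> \<open>The kernel is trivial: \<open>z = \<one>\<close> would give
    \<open>b \<otimes> a = a \<otimes> b\<close>, and neither \<open>a\<close> nor \<open>b\<close>
    can be \<open>\<one>\<close> or \<open>z\<close>, since these commute with both. As
    \<open>z\<close> is its own inverse, \<open>z \<otimes> x = \<one>\<close> forces
    \<open>x = z\<close>.\<close>
  have "z \<noteq> \<one>"
    using ne ba carr by auto
  moreover have "a \<noteq> \<one>" "b \<noteq> \<one>" "z \<noteq> a" "z \<noteq> b"
    using ne az bz carr by auto
  moreover have "a \<otimes> b \<noteq> \<one>"
    using ne carr by (metis inv_comm)
  moreover have "z \<otimes> x \<noteq> \<one>" if "x \<in> carrier G" "z \<noteq> x" for x
    using that carr zz by (metis Units_eq Units_l_cancel)
  moreover have "z \<noteq> a \<otimes> b"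
  proof
    assume "z = a \<otimes> b"
    then have "a = b" using aa carr by (metis Units_eq Units_l_cancel)
    then show False using ne by simp
  qed
  ultimately have "f q \<noteq> \<one>" if "q \<in> carrier Q8" "q \<noteq> \<one>\<^bsub>Q8\<^esub>" for q
    using that carr by (auto simp: f_def carrier_Q8 one_Q8)
  then have "inj_on f (carrier Q8)"
    unfolding f.inj_on_one_iff by blast
  with hom show ?thesis unfolding mon_def by blast
qed

text \<open>The subgroup generated by the central involution \<open>c\<close> meets the image of
  \<open>f\<close> trivially, so \<open>c\<close> can be the image of the new generator: multiply
  \<open>f\<close> by \<open>c\<close> raised to the last coordinate.\<close>

lemma (in group) mon_Z2_power_Suc:
  fixes H :: "('c, 'd) monoid_scheme" and f :: "'c \<times> (nat \<Rightarrow> int) \<Rightarrow> 'a"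
  assumes f: "f \<in> mon (H \<times>\<times> Z2_power k) G" and "group H"
    and c: "c \<in> carrier G" "c \<otimes> c = \<one>" "\<And>x. x \<in> carrier G \<Longrightarrow> c \<otimes> x = x \<otimes> c"
    and nim: "c \<notin> f ` carrier (H \<times>\<times> Z2_power k)"
  shows "\<exists>f'. f' \<in> mon (H \<times>\<times> Z2_power (Suc k)) G"
proof -
  interpret H: group H by fact
  let ?D = "H \<times>\<times> Z2_power k" and ?D' = "H \<times>\<times> Z2_power (Suc k)"
  define \<pi> where "\<pi> = (\<lambda>x :: 'c \<times> (nat \<Rightarrow> int). (fst x, restrict (snd x) {..<k}))"
  \<comment> \<open>The new coordinate has index \<open>k\<close>; on the carrier it is 0 or 1, so
    \<open>t x\<close> is \<open>c\<close> to that power.\<close>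
  define t where "t = (\<lambda>x :: 'c \<times> (nat \<Rightarrow> int). if snd x k = 0 then \<one> else c)"
  define f' where "f' = (\<lambda>x. f (\<pi> x) \<otimes> t x)"
  have fhom: "f \<in> hom ?D G" and finj: "inj_on f (carrier ?D)"
    using f by (auto simp: mon_def)
  interpret f: group_hom ?D G f
    using fhom DirProd_group[OF \<open>group H\<close> group_Z2_power] is_group
    by (simp add: group_hom_def group_hom_axioms_def)
  have \<pi>: "\<pi> x \<in> carrier ?D" if "x \<in> carrier ?D'" for x
    using that by (auto simp: \<pi>_def restrict_carrier_Z2_power)
  have t: "t x \<in> carrier G" for x
    using c(1) by (auto simp: t_def)
  have t_central: "t x \<otimes> y = y \<otimes> t x" if "y \<in> carrier G" for x y
    using c(3) that by (simp add: t_def)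
  have \<pi>_mult: "\<pi> (x \<otimes>\<^bsub>?D'\<^esub> y) = \<pi> x \<otimes>\<^bsub>?D\<^esub> \<pi> y" for x y
    by (auto simp: \<pi>_def mult_DirProd' mult_Z2_power intro!: ext)
  have t_mult: "t (x \<otimes>\<^bsub>?D'\<^esub> y) = t x \<otimes> t y" if "x \<in> carrier ?D'" "y \<in> carrier ?D'" for x y
  proof -
    have "snd x \<in> (\<Pi>\<^sub>E i\<in>{..<Suc k}. {0, 1})" "snd y \<in> (\<Pi>\<^sub>E i\<in>{..<Suc k}. {0, 1})"
      using that by (simp_all add: mem_Times_iff carrier_Z2_power)
    then have "snd x k \<in> {0, 1}" "snd y k \<in> {0, 1}"
      by (blast intro: lessThan_iff[THEN iffD2])+
    then show ?thesis
      using c(1,2) by (auto simp: t_def mult_DirProd' mult_Z2_power)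
  qed
  have hom: "f' \<in> hom ?D' G"
  proof (rule homI)
    fix x y assume xy: "x \<in> carrier ?D'" "y \<in> carrier ?D'"
    have "f' (x \<otimes>\<^bsub>?D'\<^esub> y) = f (\<pi> x) \<otimes> (f (\<pi> y) \<otimes> t x) \<otimes> t y"
      using \<pi>[OF xy(1)] \<pi>[OF xy(2)] t
      by (simp only: f'_def \<pi>_mult t_mult[OF xy] f.hom_mult f.hom_closed m_assoc m_closed)
    also have "\<dots> = f' x \<otimes> f' y"
      using \<pi>[OF xy(1)] \<pi>[OF xy(2)] t
      by (simp only: f'_def t_central[OF f.hom_closed[OF \<pi>[OF xy(2)]], symmetric]
          f.hom_closed m_assoc m_closed)
    finally show "f' (x \<otimes>\<^bsub>?D'\<^esub> y) = f' x \<otimes> f' y" .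
  next
    fix x assume "x \<in> carrier ?D'"
    then show "f' x \<in> carrier G"
      unfolding f'_def using \<pi> t by (metis f.hom_closed m_closed)
  qed
  interpret f': group_hom ?D' G f'
    using hom DirProd_group[OF \<open>group H\<close> group_Z2_power] is_group
    by (simp add: group_hom_def group_hom_axioms_def)
  have "x = \<one>\<^bsub>?D'\<^esub>" if x: "x \<in> carrier ?D'" and fx: "f' x = \<one>" for x
  proof (cases "snd x k = 0")
    case True
    then have "f (\<pi> x) = \<one>"
      using fx f.hom_closed[OF \<pi>[OF x]] by (simp add: f'_def t_def)
    then have "\<pi> x = \<one>\<^bsub>?D\<^esub>"
      using finj \<pi>[OF x] unfolding f.inj_on_one_iff by blast
    then show ?thesis
      using x True by (auto simp: \<pi>_def intro!: Z2_power_eq_one_Suc prod_eqI)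
  next
    \<comment> \<open>Here \<open>f (\<pi> x)\<close> is the inverse of \<open>c\<close>, hence
      \<open>c\<close> itself, which lies outside the image.\<close>
    case False
    then have "f (\<pi> x) \<otimes> c = c \<otimes> c"
      using fx c(2) by (simp add: f'_def t_def)
    then have "f (\<pi> x) = c"
      using c(1) f.hom_closed[OF \<pi>[OF x]] by simp
    then show ?thesis
      using nim \<pi>[OF x] by blast
  qed
  then have "inj_on f' (carrier ?D')"
    unfolding f'.inj_on_one_iff by blast
  with hom show ?thesis unfolding mon_def by blast
qed

section \<open>Noncommuting pairs and their common centralizer\<close>

text \<open>Yields the relations that \<open>mon_Q8\<close> asks for, with
  \<open>z = a \<otimes> a\<close>. All follow from aba = b and bab = a; for instance bb = (aba)b =
  a(bab) = aa.\<close>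

lemma (in group) noncommuting_pair:
  assumes P: "conj_trivial_or_inverting G"
    and carr: "a \<in> carrier G" "b \<in> carrier G" and ne: "a \<otimes> b \<noteq> b \<otimes> a"
  shows "b \<otimes> b = a \<otimes> a" and "(a \<otimes> a) \<otimes> (a \<otimes> a) = \<one>" and "b \<otimes> a = (a \<otimes> a) \<otimes> (a \<otimes> b)"
proof -
  have aba: "a \<otimes> b \<otimes> a = b"
    using conj_trivial_or_invertingD[OF P carr ne] .
  have bab: "b \<otimes> a \<otimes> b = a"
    using conj_trivial_or_invertingD[OF P carr(2,1)] ne by metis
  have "b \<otimes> b = a \<otimes> (b \<otimes> a \<otimes> b)"
    using aba carr by (metis m_assoc m_closed)
  then show bb: "b \<otimes> b = a \<otimes> a"
    using bab by simp
  have comm: "b \<otimes> (a \<otimes> a) = (a \<otimes> a) \<otimes> b"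
    using carr by (simp flip: bb add: m_assoc)
  \<comment> \<open>Substituting aba = b into itself gives b = aabaa, and aa = bb commutes with
    b.\<close>
  have "b = a \<otimes> (a \<otimes> b \<otimes> a) \<otimes> a"
    using aba by simp
  also have "\<dots> = (a \<otimes> a) \<otimes> (b \<otimes> (a \<otimes> a))"
    using carr by (simp add: m_assoc)
  also have "\<dots> = (a \<otimes> a) \<otimes> (a \<otimes> a) \<otimes> b"
    using carr by (simp add: comm m_assoc)
  finally show a4: "(a \<otimes> a) \<otimes> (a \<otimes> a) = \<one>"
    using carr by (metis m_closed r_cancel_one')
  have "(a \<otimes> a) \<otimes> (a \<otimes> b) = (a \<otimes> a) \<otimes> (a \<otimes> (a \<otimes> b \<otimes> a))"
    using aba by simp
  also have "\<dots> = (a \<otimes> a) \<otimes> (a \<otimes> a) \<otimes> (b \<otimes> a)"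
    using carr by (simp add: m_assoc)
  finally show "b \<otimes> a = (a \<otimes> a) \<otimes> (a \<otimes> b)"
    using a4 carr by simp
qed

text \<open>The element ac does not commute with b either, so (ac)b(ac) = b. Collecting both factors
  c on the right turns this into (aba)cc = b, where aba = b.\<close>

lemma (in group) centralizer_exponent_2:
  assumes P: "conj_trivial_or_inverting G"
    and carr: "a \<in> carrier G" "b \<in> carrier G" and ne: "a \<otimes> b \<noteq> b \<otimes> a"
    and c: "c \<in> carrier G" "c \<otimes> a = a \<otimes> c" "c \<otimes> b = b \<otimes> c"
  shows "c \<otimes> c = \<one>"
proof -
  have "(a \<otimes> c) \<otimes> b = (a \<otimes> b) \<otimes> c" "b \<otimes> (a \<otimes> c) = (b \<otimes> a) \<otimes> c"
    using carr c by (simp_all add: m_assoc)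
  then have "(a \<otimes> c) \<otimes> b \<noteq> b \<otimes> (a \<otimes> c)"
    using ne carr c by simp
  then have "b = (a \<otimes> c) \<otimes> b \<otimes> (a \<otimes> c)"
    using conj_trivial_or_invertingD[OF P] carr c by simp
  also have "\<dots> = a \<otimes> (c \<otimes> b) \<otimes> (a \<otimes> c)"
    using carr c(1) by (simp add: m_assoc)
  also have "\<dots> = a \<otimes> b \<otimes> (c \<otimes> a) \<otimes> c"
    using carr c(1) by (simp add: c(3) m_assoc)
  also have "\<dots> = (a \<otimes> b \<otimes> a) \<otimes> (c \<otimes> c)"
    using carr c(1) by (simp add: c(2) m_assoc)
  also have "a \<otimes> b \<otimes> a = b"
    using conj_trivial_or_invertingD[OF P carr ne] .
  finally show ?thesis
    using carr c by (metis m_closed l_cancel_one')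
qed

text \<open>Conjugation by \<open>g\<close> fixes or inverts each of \<open>a\<close> and
  \<open>b\<close>. The four resulting patterns are exactly those of conjugation by 1, a, b and ab,
  so multiplying by the matching element cancels the action of \<open>g\<close>.\<close>

lemma (in group) mult_into_centralizer:
  assumes P: "conj_trivial_or_inverting G"
    and carr: "a \<in> carrier G" "b \<in> carrier G" and ne: "a \<otimes> b \<noteq> b \<otimes> a"
    and g: "g \<in> carrier G"
  shows "\<exists>q\<in>{\<one>, a, b, a \<otimes> b}. (q \<otimes> g) \<otimes> a = a \<otimes> (q \<otimes> g) \<and> (q \<otimes> g) \<otimes> b = b \<otimes> (q \<otimes> g)"
proof -
  define z where "z = a \<otimes> a"
  have z: "z \<in> carrier G" "a \<otimes> a = z" "b \<otimes> b = z" "z \<otimes> z = \<one>" "b \<otimes> a = z \<otimes> (a \<otimes> b)"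
    using carr noncommuting_pair[OF P carr ne] by (auto simp: z_def)
  have az: "a \<otimes> z = z \<otimes> a" and bz: "b \<otimes> z = z \<otimes> b"
    using carr by (metis z(2) m_assoc, metis z(3) m_assoc)
  have left: "a \<otimes> (a \<otimes> x) = z \<otimes> x" "b \<otimes> (b \<otimes> x) = z \<otimes> x" "z \<otimes> (z \<otimes> x) = x"
    "b \<otimes> (a \<otimes> x) = z \<otimes> (a \<otimes> (b \<otimes> x))" "a \<otimes> (z \<otimes> x) = z \<otimes> (a \<otimes> x)" "b \<otimes> (z \<otimes> x) = z \<otimes> (b \<otimes> x)"
    if "x \<in> carrier G" for x
    using that carr z(1) by (simp_all flip: m_assoc add: z az bz)
  \<comment> \<open>Since \<open>z\<close> is an involution, \<open>z \<otimes> x\<close> is the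
    inverse of \<open>x\<close>; this is the inverting alternative in the normal form used by
    \<open>table\<close>.\<close>
  have inverted: "g \<otimes> x = z \<otimes> (x \<otimes> g)"
    if "x \<in> carrier G" "x \<otimes> x = z" "x \<otimes> g \<noteq> g \<otimes> x" for x
  proof -
    have "x \<otimes> g \<otimes> x = g"
      using conj_trivial_or_invertingD[OF P] that g by blast
    then have "z \<otimes> (x \<otimes> g) = z \<otimes> (x \<otimes> (x \<otimes> g \<otimes> x))"
      by simp
    also have "\<dots> = z \<otimes> ((x \<otimes> x) \<otimes> (g \<otimes> x))"
      using that(1) g z(1) by (simp add: m_assoc)
    also have "\<dots> = g \<otimes> x"
      using that z left g by simp
    finally show ?thesis ..
  qed
  note table = z az bz left m_assoc carr g
  consider "g \<otimes> a = a \<otimes> g" "g \<otimes> b = b \<otimes> g" | "g \<otimes> a = a \<otimes> g" "g \<otimes> b = z \<otimes> (b \<otimes> g)"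
    | "g \<otimes> a = z \<otimes> (a \<otimes> g)" "g \<otimes> b = b \<otimes> g" | "g \<otimes> a = z \<otimes> (a \<otimes> g)" "g \<otimes> b = z \<otimes> (b \<otimes> g)"
    using inverted[of a] inverted[of b] z carr by metis
  then show ?thesis
  proof cases
    case 1
    then show ?thesis by (intro bexI[of _ \<one>]) (simp_all add: table)
  next
    case 2
    then show ?thesis by (intro bexI[of _ a]) (simp_all add: table)
  next
    case 3
    then show ?thesis by (intro bexI[of _ b]) (simp_all add: table)
  next
    case 4
    then show ?thesis by (intro bexI[of _ "a \<otimes> b"]) (simp_all add: table)
  qed
qed

text \<open>Some \<open>q\<close> among 1, a, b, ab brings \<open>h\<close> into the centralizer of
  \<open>a\<close> and \<open>b\<close>. That centralizer has exponent 2, hence is abelian, so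
  \<open>c\<close> commutes with \<open>q \<otimes> h\<close>; it also commutes with
  \<open>q\<close>, and therefore with \<open>h\<close>.\<close>

lemma (in group) centralizer_central:
  assumes P: "conj_trivial_or_inverting G"
    and carr: "a \<in> carrier G" "b \<in> carrier G" and ne: "a \<otimes> b \<noteq> b \<otimes> a"
    and c: "c \<in> carrier G" "c \<otimes> a = a \<otimes> c" "c \<otimes> b = b \<otimes> c"
    and h: "h \<in> carrier G"
  shows "c \<otimes> h = h \<otimes> c"
proof -
  obtain q where q: "q \<in> {\<one>, a, b, a \<otimes> b}"
    and qh: "(q \<otimes> h) \<otimes> a = a \<otimes> (q \<otimes> h)" "(q \<otimes> h) \<otimes> b = b \<otimes> (q \<otimes> h)"
    using mult_into_centralizer[OF P carr ne h] by blast
  define c' where "c' = q \<otimes> h"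
  have qc: "q \<in> carrier G" using q carr by auto
  have c': "c' \<in> carrier G" "c' \<otimes> a = a \<otimes> c'" "c' \<otimes> b = b \<otimes> c'"
    using qh qc h by (auto simp: c'_def)
  have "(c \<otimes> c') \<otimes> x = x \<otimes> (c \<otimes> c')"
    if "x \<in> carrier G" "c \<otimes> x = x \<otimes> c" "c' \<otimes> x = x \<otimes> c'" for x
    using that c(1) c'(1) by (metis m_assoc)
  then have "(c \<otimes> c') \<otimes> (c \<otimes> c') = \<one>"
    using c c' carr by (intro centralizer_exponent_2[OF P carr ne]) auto
  moreover have "c \<otimes> c = \<one>" "c' \<otimes> c' = \<one>"
    using c c' by (auto intro: centralizer_exponent_2[OF P carr ne])
  \<comment> \<open>Inverting a product reverses its factors, and here both factors and the product
    are self-inverse.\<close>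
  ultimately have "c \<otimes> c' = c' \<otimes> c"
    using c(1) c'(1) by (metis inv_equality inv_mult_group m_closed)
  moreover have "c \<otimes> q = q \<otimes> c"
    using q c carr by (auto simp: m_assoc) (metis m_assoc)
  ultimately have "q \<otimes> (c \<otimes> h) = q \<otimes> (h \<otimes> c)"
    using c(1) qc h unfolding c'_def by (metis m_assoc)
  then show ?thesis
    using c(1) qc h by simp
qed

section \<open>Exhausting a finite noncommutative group\<close>

text \<open>An element outside the image, corrected by a factor from the image, becomes a central
  involution still outside the image, to which \<open>mon_Z2_power_Suc\<close> applies.\<close>

lemma (in group) mon_onto_or_extend:
  assumes P: "conj_trivial_or_inverting G"
    and f: "f \<in> mon (Q8 \<times>\<times> Z2_power k) G"
  shows "Q8 \<times>\<times> Z2_power k \<cong> G \<or> (\<exists>f'. f' \<in> mon (Q8 \<times>\<times> Z2_power (Suc k)) G)"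
proof (cases "carrier G \<subseteq> f ` carrier (Q8 \<times>\<times> Z2_power k)")
  case True
  then have "f \<in> iso (Q8 \<times>\<times> Z2_power k) G"
    using f by (auto simp: iso_iff mon_def hom_def)
  then show ?thesis by (auto simp: is_iso_def)
next
  case False
  then obtain g where g: "g \<in> carrier G" "g \<notin> f ` carrier (Q8 \<times>\<times> Z2_power k)"
    by blast
  let ?D = "Q8 \<times>\<times> Z2_power k"
  have fhom: "f \<in> hom ?D G" and finj: "inj_on f (carrier ?D)"
    using f by (auto simp: mon_def)
  interpret f: group_hom ?D G f
    using fhom DirProd_group[OF group_Q8 group_Z2_power] is_group
    by (simp add: group_hom_def group_hom_axioms_def)
  interpret I: subgroup "f ` carrier ?D" G
    by (rule f.img_is_subgroup)
  let ?i = "((0,1,0,0), \<one>\<^bsub>Z2_power k\<^esub>)" and ?j = "((0,0,1,0), \<one>\<^bsub>Z2_power k\<^esub>)"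
  have ij: "?i \<in> carrier ?D" "?j \<in> carrier ?D"
    by (auto simp: carrier_Q8 group.is_monoid[OF group_Z2_power] monoid.one_closed)
  \<comment> \<open>The images of i and j; they do not commute because \<open>f\<close> is
    injective.\<close>
  define a b where "a = f ?i" and "b = f ?j"
  have ab: "a \<in> f ` carrier ?D" "b \<in> f ` carrier ?D"
    using ij by (auto simp: a_def b_def)
  then have carr: "a \<in> carrier G" "b \<in> carrier G"
    by (auto intro: I.mem_carrier)
  have "?i \<otimes>\<^bsub>?D\<^esub> ?j \<noteq> ?j \<otimes>\<^bsub>?D\<^esub> ?i"
    by (simp add: mult_Q8 quaternion_mult_def)
  then have "f (?i \<otimes>\<^bsub>?D\<^esub> ?j) \<noteq> f (?j \<otimes>\<^bsub>?D\<^esub> ?i)"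
    using finj ij by (meson f.G.m_closed inj_on_eq_iff)
  then have ne: "a \<otimes> b \<noteq> b \<otimes> a"
    unfolding a_def b_def f.hom_mult[OF ij] f.hom_mult[OF ij(2,1)] .
  obtain q where q: "q \<in> {\<one>, a, b, a \<otimes> b}"
    and qg: "(q \<otimes> g) \<otimes> a = a \<otimes> (q \<otimes> g)" "(q \<otimes> g) \<otimes> b = b \<otimes> (q \<otimes> g)"
    using mult_into_centralizer[OF P carr ne g(1)] by blast
  have qI: "q \<in> f ` carrier ?D"
    using q ab I.one_closed I.m_closed by blast
  have qc: "q \<in> carrier G" by (rule I.mem_carrier[OF qI])
  have "q \<otimes> g \<notin> f ` carrier ?D"
  proof
    assume "q \<otimes> g \<in> f ` carrier ?D"
    then have "inv q \<otimes> (q \<otimes> g) \<in> f ` carrier ?D"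
      using qI I.m_closed I.m_inv_closed by blast
    then show False
      using g qc by (simp add: inv_solve_left' flip: m_assoc)
  qed
  moreover have "q \<otimes> g \<in> carrier G"
    using qc g by simp
  ultimately have "\<exists>f'. f' \<in> mon (Q8 \<times>\<times> Z2_power (Suc k)) G"
    using centralizer_exponent_2[OF P carr ne _ qg] centralizer_central[OF P carr ne _ qg]
    by (intro mon_Z2_power_Suc[OF f group_Q8, of "q \<otimes> g"]) blast+
  then show ?thesis ..
qed

text \<open>Forces the extension process to stop: the second factor alone embeds
  \<open>2 ^ k\<close> elements into \<open>G\<close>, and \<open>k < 2 ^ k\<close>.\<close>

lemma (in group) mon_Z2_power_bound:
  assumes "finite (carrier G)" "f \<in> mon (H \<times>\<times> Z2_power k) G" "group H"
  shows "k < card (carrier G)"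
proof -
  interpret H: group H by fact
  have "inj_on f (carrier (H \<times>\<times> Z2_power k))"
    "f ` carrier (H \<times>\<times> Z2_power k) \<subseteq> carrier G"
    using assms(2) by (auto simp: mon_def hom_def)
  moreover have "(\<lambda>x. (\<one>\<^bsub>H\<^esub>, x)) ` carrier (Z2_power k) \<subseteq> carrier (H \<times>\<times> Z2_power k)"
    by auto
  ultimately have "inj_on (\<lambda>x. f (\<one>\<^bsub>H\<^esub>, x)) (carrier (Z2_power k))"
    "(\<lambda>x. f (\<one>\<^bsub>H\<^esub>, x)) ` carrier (Z2_power k) \<subseteq> carrier G"
    by (auto simp: inj_on_def)
  then have "card (carrier (Z2_power k)) \<le> card (carrier G)"
    using assms(1) by (rule card_inj_on_le)
  moreover have "card (carrier (Z2_power k)) = 2 ^ k"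
    by (simp add: carrier_Z2_power card_PiE numeral_2_eq_2)
  ultimately show ?thesis
    using less_exp[of k] by linarith
qed

lemma (in group) finite_noncommutative_conj_trivial_or_inverting_iso:
  assumes P: "conj_trivial_or_inverting G" and fin: "finite (carrier G)"
    and nc: "\<not> comm_group G"
  shows "\<exists>k. G \<cong> Q8 \<times>\<times> Z2_power k"
proof (rule ccontr)
  assume not_iso: "\<not> ?thesis"
  obtain a b where carr: "a \<in> carrier G" "b \<in> carrier G" and ne: "a \<otimes> b \<noteq> b \<otimes> a"
    using nc group_comm_groupI by blast
  obtain f0 where f0: "f0 \<in> mon Q8 G"
    \<comment> \<open>\<open>refl\<close> chooses \<open>z = a \<otimes> a\<close>; the three
      conclusions of \<open>noncommuting_pair\<close> fill the next three premises in order.\<close>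
    using mon_Q8[OF carr m_closed[OF carr(1,1)] refl noncommuting_pair[OF P carr ne] ne] by blast
  have "\<exists>f. f \<in> mon (Q8 \<times>\<times> Z2_power k) G" for k
  proof (induction k)
    case 0
    \<comment> \<open>\<open>Z2_power 0\<close> has a single element, so the projection
      \<open>fst\<close> is injective.\<close>
    have "f0 \<circ> fst \<in> mon (Q8 \<times>\<times> Z2_power 0) G"
      using f0 by (auto simp: mon_def hom_def inj_on_def mult_DirProd' carrier_Z2_power)
    then show ?case by blast
  next
    case (Suc k)
    moreover have "\<not> Q8 \<times>\<times> Z2_power k \<cong> G"
      using not_iso group.iso_sym[OF DirProd_group[OF group_Q8 group_Z2_power]] by blast
    ultimately show ?case
      using mon_onto_or_extend[OF P] by blast
  qed
  then show False
    \<comment> \<open>An embedding with \<open>k = card (carrier G)\<close> would violate the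
      bound.\<close>
    using mon_Z2_power_bound[OF fin _ group_Q8] by (metis less_irrefl)
qed

section \<open>Weights of Lee metrics and bi-invariance\<close>

text \<open>The weight class of \<open>x\<close> is a part \<open>{a, inv a}\<close> of the Lee
  partition; as it contains \<open>x\<close>, it equals \<open>{x, inv x}\<close>.\<close>

lemma Lee_metric_weight_eq_iff:
  fixes G (structure)
  assumes "group G" "Lee_metric G d" and x: "x \<in> carrier G" and y: "y \<in> carrier G"
  shows "weight G d y = weight G d x \<longleftrightarrow> y = x \<or> y = inv x"
proof -
  interpret group G by fact
  let ?C = "{h \<in> carrier G. weight G d x = weight G d h}"
  let ?R = "{(g, h). g \<in> carrier G \<and> h \<in> carrier G \<and> weight G d g = weight G d h}"
  have "?R `` {x} \<in> carrier G // ?R"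
    using x by (rule quotientI)
  moreover have "?R `` {x} = ?C"
    using x by auto
  ultimately have "?C \<in> metric_partition G d"
    by (simp add: metric_partition_def)
  then have "?C \<in> Lee_partition G"
    using assms(2) by (simp add: Lee_metric_def)
  then obtain a where a: "a \<in> carrier G" "?C = {a, inv a}"
    by (auto simp: Lee_partition_def)
  have "x \<in> {a, inv a}"
    using x by (simp flip: a(2))
  then have "{a, inv a} = {x, inv x}"
    using a(1) by auto
  with a(2) have "y \<in> ?C \<longleftrightarrow> y \<in> {x, inv x}"
    by (simp only:)
  then show ?thesis
    using y by auto
qed

text \<open>There are finitely many weights, and each is taken by at most two elements.\<close>

lemma Lee_metric_finite:
  fixes G (structure)
  assumes "group G" "Lee_metric G d"
  shows "finite (carrier G)"
proof -
  interpret group G by fact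
  have "finite {x \<in> carrier G. weight G d x = w}" for w
  proof (cases "\<exists>y\<in>carrier G. weight G d y = w")
    case True
    then obtain y where y: "y \<in> carrier G" "weight G d y = w" by blast
    then have "{x \<in> carrier G. weight G d x = w} \<subseteq> {y, inv y}"
      using Lee_metric_weight_eq_iff[OF assms y(1)] by auto
    then show ?thesis by (rule finite_subset) simp
  next
    case False
    then have empty: "{x \<in> carrier G. weight G d x = w} = {}" by blast
    show ?thesis unfolding empty by (rule finite.emptyI)
  qed
  moreover have "finite (weight G d ` carrier G)"
    using assms(2) by (simp add: Lee_metric_def interval_metric_def)
  ultimately have "finite (\<Union>w\<in>weight G d ` carrier G. {x \<in> carrier G. weight G d x = w})"
    by blast
  then show ?thesis
    by (rule rev_finite_subset) blast
qed

text \<open>A right invariant metric is bi-invariant exactly when its weight is constant on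
  conjugacy classes. For a Lee metric, equal weight of \<open>x\<close> and a conjugate means that
  the conjugate is \<open>x\<close> or \<open>inv x\<close>.\<close>

lemma Lee_metric_bi_invariant_iff:
  fixes G (structure)
  assumes "group G" "Lee_metric G d"
  shows "bi_invariant_metric G d \<longleftrightarrow> conj_trivial_or_inverting G"
proof -
  interpret group G by fact
  have R: "right_invariant_metric G d"
    using assms(2) by (simp add: Lee_metric_def interval_metric_def)
  then have right: "d (x \<otimes> h) (y \<otimes> h) = d x y"
    if "x \<in> carrier G" "y \<in> carrier G" "h \<in> carrier G" for x y h
    using that by (auto simp: right_invariant_metric_def)
  \<comment> \<open>Right translation by \<open>inv y\<close> reduces all distances to weights, so
    left translation by \<open>h\<close> acts on them as conjugation.\<close>
  have dw: "d x y = weight G d (x \<otimes> inv y)" if "x \<in> carrier G" "y \<in> carrier G" for x y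
    using that right[of x y "inv y"] by (simp add: weight_def)
  have conj: "weight G d (h \<otimes> x \<otimes> inv h) = weight G d x \<longleftrightarrow> x \<otimes> h = h \<otimes> x \<or> x \<otimes> h \<otimes> x = h"
    if "x \<in> carrier G" "h \<in> carrier G" for x h
  proof -
    have "h \<otimes> x \<otimes> inv h = x \<longleftrightarrow> x \<otimes> h = h \<otimes> x"
      using that by (metis inv_solve_right' m_closed)
    moreover have "h \<otimes> x \<otimes> inv h = inv x \<longleftrightarrow> x \<otimes> h \<otimes> x = h"
      using that by (metis inv_closed inv_solve_left inv_solve_right' m_assoc m_closed)
    ultimately show ?thesis
      using Lee_metric_weight_eq_iff[OF assms that(1), of "h \<otimes> x \<otimes> inv h"] that by simp
  qed
  have "bi_invariant_metric G d \<longleftrightarrow>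
    (\<forall>x\<in>carrier G. \<forall>h\<in>carrier G. weight G d (h \<otimes> x \<otimes> inv h) = weight G d x)"
    (is "_ \<longleftrightarrow> ?W")
  proof
    assume B: "bi_invariant_metric G d"
    show ?W
    proof (intro ballI)
      fix x h assume xh: "x \<in> carrier G" "h \<in> carrier G"
      have "weight G d (h \<otimes> x \<otimes> inv h) = d (h \<otimes> x) (h \<otimes> \<one>)"
        using xh by (simp add: dw)
      also have "\<dots> = weight G d x"
        using B xh unfolding bi_invariant_metric_def weight_def by blast
      finally show "weight G d (h \<otimes> x \<otimes> inv h) = weight G d x" .
    qed
  next
    assume W: ?W
    have "d (h \<otimes> x) (h \<otimes> y) = d x y"
      if "x \<in> carrier G" "y \<in> carrier G" "h \<in> carrier G" for x y h
    proof -
      have "d (h \<otimes> x) (h \<otimes> y) = weight G d (h \<otimes> (x \<otimes> inv y) \<otimes> inv h)"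
        using that by (simp add: dw inv_mult_group m_assoc)
      also have "\<dots> = d x y"
        using W that by (simp add: dw)
      finally show ?thesis .
    qed
    then show "bi_invariant_metric G d"
      using R by (simp add: bi_invariant_metric_def)
  qed
  also have "\<dots> \<longleftrightarrow> conj_trivial_or_inverting G"
    by (simp add: conj conj_trivial_or_inverting_def)
  finally show ?thesis .
qed

theorem proposition3p5:
  fixes G :: "('a, 'b) monoid_scheme" and d :: "'a \<Rightarrow> 'a \<Rightarrow> int"
  assumes "group G"
    and "Lee_metric G d"
  shows "bi_invariant_metric G d \<longleftrightarrow>
    comm_group G \<or> (\<exists>k::nat. G \<cong> Q8 \<times>\<times> Z2_power k)"
proof -
  interpret group G by fact
  have "conj_trivial_or_inverting G" if "comm_group G"
    using comm_groupE(4)[OF that] by (simp add: conj_trivial_or_inverting_def)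
  moreover have "conj_trivial_or_inverting G" if "G \<cong> Q8 \<times>\<times> Z2_power k" for k
    using conj_trivial_or_inverting_iso[OF that is_monoid conj_trivial_or_inverting_Q8_Z2_power] .
  ultimately show ?thesis
    unfolding Lee_metric_bi_invariant_iff[OF assms]
    \<comment> \<open>The finiteness on which the exhaustion argument rests comes from the Lee
      metric itself.\<close>
    using finite_noncommutative_conj_trivial_or_inverting_iso Lee_metric_finite[OF assms] by blast
qed

end
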